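(* For every rational number $p/q \ge 1$ (with $p,q$ positive integers) there exist a finite set $D$, an integer $r\ge 1$ and a relation $R_{p,q} \subseteq D^r$ such that $\mathrm{NRD}(R_{p,q}, n) = \Theta_{p,q}(n^{p/q})$, i.e. there are constants $c_1,c_2>0$ depending only on $p,q$ with $c_1 n^{p/q}\le \mathrm{NRD}(R_{p,q},n)\le c_2 n^{p/q}$ for all sufficiently large $n$.
   Context: For a finite set $D$ and a relation $R\subseteq D^r$, an instance of $\mathrm{CSP}(R)$ is a pair $(X,Y)$ where $X$ is a finite set of variables and $Y\subseteq X^r$ is a set of clauses. An assignment $\sigma:X\to D$ satisfies a clause $y=(y_1,\dots,y_r)$ if $(\sigma(y_1),\dots,\sigma(y_r))\in R$. The instance is non-redundant if for every $y\in Y$ there is an assignment satisfying every clause in $Y\setminus\{y\}$ but not $y$. $\mathrm{NRD}(R,n)$ denotes the maximum of $|Y|$ over all non-redundant instances $(X,Y)$ of $\mathrm{CSP}(R)$ with $|X|=n$. *)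

theory Defs
  imports Complex_Main "HOL-Library.FuncSet"
begin

abbreviation tuples :: "nat \<Rightarrow> 'a set \<Rightarrow> 'a list set" where
  "tuples r A \<equiv> {xs. set xs \<subseteq> A \<and> length xs = r}"

definition csp_instance :: "nat \<Rightarrow> 'v set \<Rightarrow> 'v list set \<Rightarrow> bool" where
  "csp_instance r X Y \<longleftrightarrow> finite X \<and> Y \<subseteq> tuples r X"

definition satisfies :: "'d list set \<Rightarrow> ('v \<Rightarrow> 'd) \<Rightarrow> 'v list \<Rightarrow> bool" where
  "satisfies R \<sigma> y \<longleftrightarrow> map \<sigma> y \<in> R"

definition non_redundant ::
  "'d set \<Rightarrow> nat \<Rightarrow> 'd list set \<Rightarrow> 'v set \<Rightarrow> 'v list set \<Rightarrow> bool" where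
  "non_redundant D r R X Y \<longleftrightarrow> csp_instance r X Y \<and>
     (\<forall>y\<in>Y. \<exists>\<sigma> \<in> X \<rightarrow>\<^sub>E D. (\<forall>y'\<in>Y - {y}. satisfies R \<sigma> y') \<and> \<not> satisfies R \<sigma> y)"

text \<open>
  The maximum ranges over instances whose variables are natural numbers; this loses no generality,
  see \<open>card_le_NRD\<close> below. The set is finite and nonempty (\<open>finite_NRD_set\<close>, \<open>NRD_set_nonempty\<close>),
  so that \<^const>\<open>Max\<close> is a genuine maximum.
\<close>

definition NRD :: "'d set \<Rightarrow> nat \<Rightarrow> 'd list set \<Rightarrow> nat \<Rightarrow> nat" where
  "NRD D r R n =
     Max {card Y | (X :: nat set) (Y :: nat list set). non_redundant D r R X Y \<and> card X = n}"

lemma non_redundant_instance: "non_redundant D r R X Y \<Longrightarrow> csp_instance r X Y"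
  unfolding non_redundant_def by (rule conjunct1)

lemma finite_NRD_set:
  "finite {card Y | (X :: nat set) (Y :: nat list set). non_redundant D r R X Y \<and> card X = n}"
proof (rule finite_subset)
  have "card Y \<le> card X ^ r" if "non_redundant D r R X Y" for X :: "nat set" and Y
  proof -
    have "finite X" "Y \<subseteq> tuples r X"
      using non_redundant_instance[OF that] by (simp_all add: csp_instance_def)
    then show ?thesis
      using card_mono[OF finite_lists_length_eq, of X Y r] card_lists_length_eq[of X r] by simp
  qed
  then show "{card Y | (X :: nat set) (Y :: nat list set). non_redundant D r R X Y \<and> card X = n}
               \<subseteq> {..n ^ r}"
    by fastforce
qed simp

lemma NRD_set_nonempty:
  "{card Y | (X :: nat set) (Y :: nat list set). non_redundant D r R X Y \<and> card X = n} \<noteq> {}"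
proof -
  have "non_redundant D r R {..<n} {} \<and> card {..<n} = n"
    by (simp add: non_redundant_def csp_instance_def)
  then have "card {} \<in> {card Y | (X :: nat set) (Y :: nat list set).
      non_redundant D r R X Y \<and> card X = n}"
    by (intro CollectI exI[of _ "{..<n}"] exI[of _ "{}"]) simp
  then show ?thesis by (rule ex_in_conv[THEN iffD1, OF exI])
qed

lemma non_redundant_rename:
  assumes nr: "non_redundant D r R X Y" and inj: "inj_on f X"
  shows "non_redundant D r R (f ` X) (map f ` Y)"
  unfolding non_redundant_def
proof (intro conjI ballI)
  have X: "finite X" and Y: "Y \<subseteq> tuples r X"
    using non_redundant_instance[OF nr] by (simp_all add: csp_instance_def)
  show "csp_instance r (f ` X) (map f ` Y)"
    using X Y by (fastforce simp: csp_instance_def)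
  fix z assume "z \<in> map f ` Y"
  then obtain y where y: "y \<in> Y" "z = map f y" by auto
  then obtain \<sigma> where \<sigma>: "\<sigma> \<in> X \<rightarrow>\<^sub>E D" "\<forall>y'\<in>Y - {y}. satisfies R \<sigma> y'" "\<not> satisfies R \<sigma> y"
    using nr unfolding non_redundant_def by blast
  let ?\<tau> = "restrict (\<sigma> \<circ> inv_into X f) (f ` X)"
  have \<tau>: "map ?\<tau> (map f y') = map \<sigma> y'" if "y' \<in> Y" for y'
  proof -
    have "set y' \<subseteq> X" using that Y by auto
    then show ?thesis using inj by (auto simp: inv_into_f_f subset_iff)
  qed
  show "\<exists>\<tau> \<in> f ` X \<rightarrow>\<^sub>E D. (\<forall>z'\<in>map f ` Y - {z}. satisfies R \<tau> z') \<and> \<not> satisfies R \<tau> z"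
  proof (intro bexI[of _ ?\<tau>] conjI ballI)
    show "?\<tau> \<in> f ` X \<rightarrow>\<^sub>E D" using \<sigma>(1) inj by (auto simp: inv_into_f_f)
    show "\<not> satisfies R ?\<tau> z" using \<sigma>(3) unfolding satisfies_def y(2) \<tau>[OF y(1)] .
    fix z' assume "z' \<in> map f ` Y - {z}"
    then obtain y' where y': "y' \<in> Y - {y}" "z' = map f y'" using y by auto
    then have "y' \<in> Y" by simp
    show "satisfies R ?\<tau> z'"
      using \<sigma>(2) y'(1) unfolding satisfies_def y'(2) \<tau>[OF \<open>y' \<in> Y\<close>] by (rule bspec)
  qed
qed

lemma card_le_NRD:
  fixes X :: "'v set"
  assumes nr: "non_redundant D r R X Y"
  shows "card Y \<le> NRD D r R (card X)"
proof -
  have X: "finite X" and Y: "Y \<subseteq> tuples r X"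
    using non_redundant_instance[OF nr] by (simp_all add: csp_instance_def)
  obtain f :: "'v \<Rightarrow> nat" where f: "inj_on f X"
    using finite_imp_inj_to_nat_seg[OF X] by blast
  have "Y \<subseteq> lists X" using Y by (auto simp: lists_eq_set)
  then have "card (map f ` Y) = card Y"
    using inj_on_subset[OF inj_on_map_lists[OF f]] by (simp add: card_image)
  moreover have "card (f ` X) = card X" using f by (simp add: card_image)
  ultimately have "card Y \<in> {card Y | (X' :: nat set) (Y :: nat list set).
      non_redundant D r R X' Y \<and> card X' = card X}"
    using non_redundant_rename[OF nr f]
    by (intro CollectI exI[of _ "f ` X"] exI[of _ "map f ` Y"]) simp
  then show ?thesis unfolding NRD_def by (intro Max_ge finite_NRD_set)
qed

end

theory Submission
  imports Defs "HOL-Analysis.Convex" "HOL-Library.Nat_Bijection"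
begin

text \<open>
  Let \<open>S\<^sub>0, \<dots>, S\<^sub>p\<^sub>-\<^sub>1\<close> be the cyclic intervals of length \<open>q\<close> in \<open>{0, \<dots>, p - 1}\<close>. A tuple belongs to the
  relation if its \<open>j\<close>-th entry assigns bits to the coordinates in \<open>S\<^sub>j\<close>, all entries agree on shared
  coordinates, and not all bits are 1. Taking one variable for every \<open>j\<close> and every point of
  \<open>[N]\<^bsup>S\<^sub>j\<^esup>\<close>, the \<open>N\<^sup>p\<close> clauses given by the points \<open>x \<in> [N]\<^sup>p\<close> through their projections
  form a non-redundant instance on \<open>p N\<^sup>q\<close> variables: bit \<open>i\<close> of a variable records agreement with
  coordinate \<open>i\<close> of the clause to be violated.

  Conversely, a clause of a non-redundant instance can be violated because two entries disagree on
  a shared coordinate. For fixed entries and coordinate these clauses are the edges of a forest on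
  the variables, so there are \<open>O(n)\<close> of them. The remaining clauses are violated by the
  all-ones pattern; they carry hidden coordinates \<open>c\<^sub>0, \<dots>, c\<^sub>p\<^sub>-\<^sub>1\<close> that identify the clause and such that
  the \<open>j\<close>-th variable determines \<open>c\<close> on \<open>S\<^sub>j\<close>. Every coordinate lies in exactly \<open>q\<close> of the \<open>p\<close> sets,
  so Shearer's inequality bounds their number by \<open>n\<^bsup>p/q\<^esup>\<close>.
\<close>

section \<open>Counting tools: Hoelder, Shearer and a forest bound\<close>

text \<open>Dividing each \<open>a j\<close> by its total \<open>T j\<close> reduces to totals 1,
  where AM-GM bounds the geometric mean pointwise and the bounds sum to 1. A vanishing total makes
  the left side 0.\<close>

lemma Holder_sum_prod:
  fixes a :: "'j \<Rightarrow> 'v \<Rightarrow> real"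
  assumes "finite V" "finite K" "K \<noteq> {}" and a: "\<And>j v. j \<in> K \<Longrightarrow> v \<in> V \<Longrightarrow> a j v \<ge> 0"
  shows "(\<Sum>v\<in>V. (\<Prod>j\<in>K. a j v) powr (1 / card K)) \<le> (\<Prod>j\<in>K. \<Sum>v\<in>V. a j v) powr (1 / card K)"
proof (cases "\<exists>j\<in>K. (\<Sum>v\<in>V. a j v) = 0")
  case True
  then obtain j where "j \<in> K" "\<And>v. v \<in> V \<Longrightarrow> a j v = 0"
    using sum_nonneg_eq_0_iff[OF \<open>finite V\<close>] a by metis
  then have "(\<Prod>j\<in>K. a j v) = 0" if "v \<in> V" for v
    using that \<open>finite K\<close> by auto
  then show ?thesis by simp
next
  case False
  define T where "T j = (\<Sum>v\<in>V. a j v)" for j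
  have T: "T j > 0" if "j \<in> K" for j
    using False that a sum_nonneg[of V "a j"] unfolding T_def by force
  have "(\<Prod>j\<in>K. a j v) powr (1 / card K)
      \<le> (\<Prod>j\<in>K. T j) powr (1 / card K) * (\<Sum>j\<in>K. a j v / T j / card K)" if "v \<in> V" for v
  proof -
    have "(\<Prod>j\<in>K. a j v) = (\<Prod>j\<in>K. T j) * (\<Prod>j\<in>K. a j v / T j)"
      unfolding prod.distrib[symmetric] using T by (intro prod.cong) force+
    moreover have "(\<Prod>j\<in>K. T j) \<ge> 0" "(\<Prod>j\<in>K. a j v / T j) \<ge> 0"
      using T a that by (force intro!: prod_nonneg divide_nonneg_pos simp: less_imp_le)+
    moreover have "(\<Prod>j\<in>K. a j v / T j) powr (1 / card K) \<le> (\<Sum>j\<in>K. a j v / T j / card K)"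
      using T a that assms by (intro arith_geom_mean) (auto intro!: divide_nonneg_pos)
    ultimately show ?thesis
      by (simp add: powr_mult mult_left_mono del: prod_dividef)
  qed
  then have "(\<Sum>v\<in>V. (\<Prod>j\<in>K. a j v) powr (1 / card K))
      \<le> (\<Sum>v\<in>V. (\<Prod>j\<in>K. T j) powr (1 / card K) * (\<Sum>j\<in>K. a j v / T j / card K))"
    by (rule sum_mono)
  also have "\<dots> = (\<Prod>j\<in>K. T j) powr (1 / card K) * (\<Sum>j\<in>K. \<Sum>v\<in>V. a j v / T j / card K)"
    unfolding sum_distrib_left[symmetric] by (subst sum.swap) (rule refl)
  also have "(\<Sum>j\<in>K. \<Sum>v\<in>V. a j v / T j / card K) = (\<Sum>j\<in>K. 1 / card K)"
  proof (rule sum.cong)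
    fix j assume "j \<in> K"
    have "(\<Sum>v\<in>V. a j v / T j / card K) = T j / T j / card K"
      unfolding T_def sum_divide_distrib[symmetric] ..
    then show "(\<Sum>v\<in>V. a j v / T j / card K) = 1 / card K"
      using T[OF \<open>j \<in> K\<close>] by simp
  qed simp
  also have "\<dots> = 1" using assms by simp
  finally show ?thesis by (simp add: T_def)
qed

text \<open>On a fibre of coordinate \<open>i\<close> this coordinate is constant, so forgetting it
  loses no information.\<close>

lemma card_restrict_insert:
  assumes "finite C" "i \<notin> A"
  shows "card ((\<lambda>x. restrict x (insert i A)) ` C)
    = (\<Sum>v\<in>(\<lambda>x. x i) ` C. card ((\<lambda>x. restrict x A) ` {x \<in> C. x i = v}))"
proof -
  let ?P = "\<lambda>v. (\<lambda>x. restrict x (insert i A)) ` {x \<in> C. x i = v}"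
  have "(\<lambda>x. restrict x (insert i A)) ` C = (\<Union>v\<in>(\<lambda>x. x i) ` C. ?P v)"
    by auto
  moreover have "?P v \<inter> ?P w = {}" if "v \<noteq> w" for v w
    using that by (auto dest!: fun_cong[where x = i])
  ultimately have "card ((\<lambda>x. restrict x (insert i A)) ` C) = (\<Sum>v\<in>(\<lambda>x. x i) ` C. card (?P v))"
    using \<open>finite C\<close> card_UN_disjoint[of "(\<lambda>x. x i) ` C" ?P] by auto
  moreover have "card (?P v) = card ((\<lambda>x. restrict x A) ` {x \<in> C. x i = v})" for v
  proof (rule bij_betw_same_card[of "\<lambda>g. restrict g A"])
    have "restrict x (insert i A) = restrict y (insert i A)"
      if "x i = v" "y i = v" "restrict x A = restrict y A" for x y
    proof
      fix k show "restrict x (insert i A) k = restrict y (insert i A) k"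
        using that(1,2) fun_cong[OF that(3), of k] by (cases "k \<in> A") auto
    qed
    moreover have "restrict (restrict x (insert i A)) A = restrict x A" for x :: "'a \<Rightarrow> 'b"
      by (auto simp: restrict_def)
    ultimately show "bij_betw (\<lambda>g. restrict g A) (?P v) ((\<lambda>x. restrict x A) ` {x \<in> C. x i = v})"
      by (auto simp: bij_betw_def inj_on_def image_image)
  qed
  ultimately show ?thesis by simp
qed

text \<open>Induction on \<open>I\<close>: fibre \<open>C\<close> over the values of the new
  coordinate \<open>i\<close> and apply the hypothesis to each fibre. Exactly \<open>q\<close> of
  the sets contain \<open>i\<close>, as Hoelder with exponent \<open>1 / q\<close> requires for the
  sum over the fibres.\<close>

lemma Shearer_inequality:
  fixes C :: "('i \<Rightarrow> 'b) set" and S :: "'j \<Rightarrow> 'i set"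
  assumes "finite J" "q > 0" "finite I" "finite C"
    and "\<And>i. i \<in> I \<Longrightarrow> card {j \<in> J. i \<in> S j} = q"
  shows "real (card ((\<lambda>x. restrict x I) ` C))
    \<le> (\<Prod>j\<in>J. real (card ((\<lambda>x. restrict x (S j \<inter> I)) ` C))) powr (1 / q)"
  using assms(3-)
proof (induction I arbitrary: C rule: finite_induct)
  case empty
  show ?case
  proof (cases "C = {}")
    case False
    then show ?thesis by (simp add: image_constant_conv)
  qed simp
next
  case (insert i I)
  define pr where "pr A C = real (card ((\<lambda>x. restrict x A) ` C))" for A and C :: "('i \<Rightarrow> 'b) set"
  define V where "V = (\<lambda>x. x i) ` C"
  define Cv where "Cv v = {x \<in> C. x i = v}" for v
  define K where "K = {j \<in> J. i \<in> S j}"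
  have K: "card K = q" "finite K" "K \<noteq> {}" "K \<subseteq> J"
    using insert.prems(2)[of i] \<open>q > 0\<close> \<open>finite J\<close>
    unfolding K_def by (auto simp: card_gt_0_iff)
  have V: "finite V" using insert.prems by (simp add: V_def)
  \<comment> \<open>Sets avoiding \<open>i\<close>: their projections of a fibre are at most those
    of \<open>C\<close>, a bound independent of \<open>v\<close> that can leave the sum.\<close>
  define M where "M = (\<Prod>j\<in>J - K. pr (S j \<inter> insert i I) C)"
  have M: "M \<ge> 0" unfolding M_def pr_def by (simp add: prod_nonneg)
  have split: "pr (insert i A) C = (\<Sum>v\<in>V. pr A (Cv v))" if "i \<notin> A" for A
    using card_restrict_insert[OF insert.prems(1) that] by (simp add: pr_def V_def Cv_def)
  have "pr I (Cv v) \<le> M powr (1 / q) * (\<Prod>j\<in>K. pr (S j \<inter> I) (Cv v)) powr (1 / q)" for v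
  proof -
    have "(\<Prod>j\<in>J - K. pr (S j \<inter> I) (Cv v)) \<le> M"
      unfolding M_def
    proof (rule prod_mono)
      fix j assume "j \<in> J - K"
      then have "S j \<inter> insert i I = S j \<inter> I" by (auto simp: K_def)
      then show "0 \<le> pr (S j \<inter> I) (Cv v) \<and> pr (S j \<inter> I) (Cv v) \<le> pr (S j \<inter> insert i I) C"
        using insert.prems(1) by (auto simp: pr_def Cv_def intro!: card_mono)
    qed
    moreover have "(\<Prod>j\<in>J. pr (S j \<inter> I) (Cv v))
        = (\<Prod>j\<in>J - K. pr (S j \<inter> I) (Cv v)) * (\<Prod>j\<in>K. pr (S j \<inter> I) (Cv v))"
      using prod.subset_diff[OF K(4) \<open>finite J\<close>] by (simp add: mult.commute)
    moreover have "(\<Prod>j\<in>K. pr (S j \<inter> I) (Cv v)) \<ge> 0"  "(\<Prod>j\<in>J - K. pr (S j \<inter> I) (Cv v)) \<ge> 0"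
      by (auto simp: pr_def intro: prod_nonneg)
    moreover have "pr I (Cv v) \<le> (\<Prod>j\<in>J. pr (S j \<inter> I) (Cv v)) powr (1 / q)"
      unfolding pr_def using insert.prems by (intro insert.IH) (auto simp: Cv_def)
    ultimately show ?thesis
      using M by (auto simp: powr_mult intro: order_trans intro!: powr_mono2 mult_right_mono)
  qed
  then have "pr (insert i I) C \<le> (\<Sum>v\<in>V. M powr (1 / q) * (\<Prod>j\<in>K. pr (S j \<inter> I) (Cv v)) powr (1 / q))"
    unfolding split[OF insert.hyps(2)] by (rule sum_mono)
  also have "\<dots> = M powr (1 / q) * (\<Sum>v\<in>V. (\<Prod>j\<in>K. pr (S j \<inter> I) (Cv v)) powr (1 / q))"
    by (simp add: sum_distrib_left)
  also have "\<dots> \<le> M powr (1 / q) * (\<Prod>j\<in>K. \<Sum>v\<in>V. pr (S j \<inter> I) (Cv v)) powr (1 / q)"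
    using Holder_sum_prod[of V K "\<lambda>j v. pr (S j \<inter> I) (Cv v)"] V K
    by (intro mult_left_mono) (auto simp: pr_def)
  also have "(\<Prod>j\<in>K. \<Sum>v\<in>V. pr (S j \<inter> I) (Cv v)) = (\<Prod>j\<in>K. pr (S j \<inter> insert i I) C)"
  proof (rule prod.cong)
    fix j assume "j \<in> K"
    then have "S j \<inter> insert i I = insert i (S j \<inter> I)" by (auto simp: K_def)
    then show "(\<Sum>v\<in>V. pr (S j \<inter> I) (Cv v)) = pr (S j \<inter> insert i I) C"
      using split[of "S j \<inter> I"] insert.hyps(2) by simp
  qed simp
  also have "M powr (1 / q) * (\<Prod>j\<in>K. pr (S j \<inter> insert i I) C) powr (1 / q)
      = (\<Prod>j\<in>J. pr (S j \<inter> insert i I) C) powr (1 / q)"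
    unfolding prod.subset_diff[OF K(4) \<open>finite J\<close>] M_def[symmetric]
    using M by (simp add: powr_mult pr_def prod_nonneg)
  finally show ?case unfolding pr_def .
qed

text \<open>The graph on \<open>V\<close> with edges \<open>a e\<close>, \<open>b e\<close> is a forest, since \<open>h e\<close> separates the ends of \<open>e\<close>
  only.\<close>

lemma card_le_separated_edges:
  fixes a b :: "'e \<Rightarrow> 'v"
  assumes "finite E" "finite V" "a ` E \<subseteq> V" "b ` E \<subseteq> V"
    and "\<And>e. e \<in> E \<Longrightarrow> h e (a e) \<noteq> h e (b e)"
    and "\<And>e e'. e \<in> E \<Longrightarrow> e' \<in> E \<Longrightarrow> e' \<noteq> e \<Longrightarrow> h e (a e') = h e (b e')"
  shows "card E \<le> card V"
  using assms
proof (induction E arbitrary: V a b rule: finite_induct)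
  case (insert e E)
  \<comment> \<open>Contracts the edge \<open>e\<close>, moving \<open>b e\<close> to
    \<open>a e\<close>. The separators of the other edges agree at these two ends, so they survive
    the contraction, with one vertex fewer.\<close>
  define \<phi> where "\<phi> v = (if v = b e then a e else v)" for v
  have ne: "a e \<noteq> b e" using insert.prems(4)[of e] by auto
  have h: "h e' (\<phi> v) = h e' v" if "e' \<in> E" for e' v
    using insert.prems(5)[of e' e] insert.hyps(2) that by (auto simp: \<phi>_def)
  have "card E \<le> card (V - {b e})"
  proof (rule insert.IH[of _ "\<phi> \<circ> a" "\<phi> \<circ> b"])
    show "(\<phi> \<circ> a) ` E \<subseteq> V - {b e}" "(\<phi> \<circ> b) ` E \<subseteq> V - {b e}"
      using insert.prems(2,3) ne by (auto simp: \<phi>_def)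
  next
    fix e' assume "e' \<in> E"
    then show "h e' ((\<phi> \<circ> a) e') \<noteq> h e' ((\<phi> \<circ> b) e')"
      using insert.prems(4)[of e'] by (simp add: h)
  next
    fix e1 e2 assume "e1 \<in> E" "e2 \<in> E" "e2 \<noteq> e1"
    then show "h e1 ((\<phi> \<circ> a) e2) = h e1 ((\<phi> \<circ> b) e2)"
      using insert.prems(5)[of e1 e2] by (simp add: h)
  qed (use insert.prems in auto)
  moreover have "b e \<in> V" "V \<noteq> {}" using insert.prems(3) by auto
  ultimately show ?case
    using insert.hyps insert.prems(1) card_gt_0_iff[of V] by simp
qed simp

section \<open>The relation of a set system and the upper bound\<close>

text \<open>A value in \<open>cover_domain m\<close> encodes an assignment of bits to all \<open>m\<close> coordinates, but
  position \<open>j\<close> of a tuple is only ever tested on the coordinates in \<open>S j\<close>.\<close>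

definition cover_domain :: "nat \<Rightarrow> nat set" where
  "cover_domain m = set_encode ` Pow {..<m}"

definition cover_relation :: "nat \<Rightarrow> nat \<Rightarrow> (nat \<Rightarrow> nat set) \<Rightarrow> nat list set" where
  "cover_relation m r S = {xs \<in> tuples r (cover_domain m).
     (\<forall>j<r. \<forall>k<r. \<forall>i\<in>S j \<inter> S k. i \<in> set_decode (xs ! j) \<longleftrightarrow> i \<in> set_decode (xs ! k)) \<and>
     \<not> (\<forall>j<r. S j \<subseteq> set_decode (xs ! j))}"

lemma satisfies_cover_relation_iff:
  assumes "length y = r" "\<sigma> ` set y \<subseteq> cover_domain m"
  shows "satisfies (cover_relation m r S) \<sigma> y \<longleftrightarrow>
     (\<forall>j<r. \<forall>k<r. \<forall>i\<in>S j \<inter> S k. i \<in> set_decode (\<sigma> (y ! j)) \<longleftrightarrow> i \<in> set_decode (\<sigma> (y ! k))) \<and>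
     \<not> (\<forall>j<r. S j \<subseteq> set_decode (\<sigma> (y ! j)))"
  using assms by (simp add: satisfies_def cover_relation_def cong: conj_cong)

lemma satisfies_cover_relationD:
  assumes "satisfies (cover_relation m r S) \<sigma> y"
  shows "\<And>i j k. \<lbrakk>j < r; k < r; i \<in> S j; i \<in> S k\<rbrakk> \<Longrightarrow>
      i \<in> set_decode (\<sigma> (y ! j)) \<longleftrightarrow> i \<in> set_decode (\<sigma> (y ! k))"
    and "\<not> (\<forall>j<r. S j \<subseteq> set_decode (\<sigma> (y ! j)))"
proof -
  have "length y = r" "\<sigma> ` set y \<subseteq> cover_domain m"
    using assms by (auto simp: satisfies_def cover_relation_def)
  from assms[unfolded satisfies_cover_relation_iff[OF this]]
  show "\<And>i j k. \<lbrakk>j < r; k < r; i \<in> S j; i \<in> S k\<rbrakk> \<Longrightarrow>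
      i \<in> set_decode (\<sigma> (y ! j)) \<longleftrightarrow> i \<in> set_decode (\<sigma> (y ! k))"
    and "\<not> (\<forall>j<r. S j \<subseteq> set_decode (\<sigma> (y ! j)))"
    by (blast, blast)
qed

text \<open>Each clause gives an edge from its \<open>j\<close>-th to its \<open>k\<close>-th
  variable. Bit \<open>i\<close> of \<open>\<sigma> y\<close> differs at the ends of the edge of
  \<open>y\<close> and agrees at the ends of every other edge.\<close>

lemma card_le_inconsistent:
  assumes "finite X" "Z \<subseteq> tuples r X" "j < r" "k < r" "i \<in> S j \<inter> S k"
    and fail: "\<And>y. y \<in> Z \<Longrightarrow> i \<in> set_decode (\<sigma> y (y ! j)) \<longleftrightarrow> i \<notin> set_decode (\<sigma> y (y ! k))"
    and sat: "\<And>y y'. y \<in> Z \<Longrightarrow> y' \<in> Z \<Longrightarrow> y' \<noteq> y \<Longrightarrow> satisfies (cover_relation m r S) (\<sigma> y) y'"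
  shows "card Z \<le> card X"
proof (rule card_le_separated_edges[where a = "\<lambda>y. y ! j" and b = "\<lambda>y. y ! k"
      and h = "\<lambda>y v. i \<in> set_decode (\<sigma> y v)"])
  show "finite Z"
    using finite_subset[OF assms(2) finite_lists_length_eq[OF \<open>finite X\<close>]] .
  show "(\<lambda>y. y ! j) ` Z \<subseteq> X" "(\<lambda>y. y ! k) ` Z \<subseteq> X"
    using assms(2-4) by (auto simp: subset_iff)
  show "(i \<in> set_decode (\<sigma> y (y ! j))) \<noteq> (i \<in> set_decode (\<sigma> y (y ! k)))" if "y \<in> Z" for y
    using fail[OF that] by simp
next
  fix y y' assume y: "y \<in> Z" "y' \<in> Z" "y' \<noteq> y"
  show "(i \<in> set_decode (\<sigma> y (y' ! j))) = (i \<in> set_decode (\<sigma> y (y' ! k)))"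
    using satisfies_cover_relationD(1)[OF sat[OF y] assms(3,4)] assms(5) by blast
qed fact

text \<open>Hidden coordinates embed the clauses injectively. Their projection to \<open>S j\<close>
  is a function of one variable, so it takes at most \<open>card X\<close> values; Shearer's
  inequality combines these bounds.\<close>

lemma card_le_consistent:
  assumes X: "finite X" and Z: "Z \<subseteq> tuples r X" and "q > 0" "r > 0"
    and S: "\<And>j. j < r \<Longrightarrow> S j \<subseteq> {..<m}" and cover: "\<And>i. i < m \<Longrightarrow> card {j \<in> {..<r}. i \<in> S j} = q"
    and full: "\<And>y j. y \<in> Z \<Longrightarrow> j < r \<Longrightarrow> S j \<subseteq> set_decode (\<sigma> y (y ! j))"
    and sat: "\<And>y y'. y \<in> Z \<Longrightarrow> y' \<in> Z \<Longrightarrow> y' \<noteq> y \<Longrightarrow> satisfies (cover_relation m r S) (\<sigma> y) y'"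
  shows "real (card Z) \<le> real (card X) powr (r / q)"
proof -
  \<comment> \<open>the hidden coordinates of the clause \<open>y\<close>; by consistency any \<open>j\<close> with \<open>i \<in> S j\<close> gives the
    same set, so the \<open>j\<close>-th variable of \<open>y\<close> determines \<open>c y\<close> on \<open>S j\<close>\<close>
  define c where "c y i = {z \<in> Z. \<exists>j<r. i \<in> S j \<and> i \<in> set_decode (\<sigma> z (y ! j))}" for y i
  \<comment> \<open>\<open>sat\<close> says nothing about \<open>y = z\<close>, but there
    \<open>full\<close> makes all tested bits 1, so the entries still agree.\<close>
  have cons: "i \<in> set_decode (\<sigma> z (y ! j)) \<longleftrightarrow> i \<in> set_decode (\<sigma> z (y ! k))"
    if "y \<in> Z" "z \<in> Z" "j < r" "k < r" "i \<in> S j" "i \<in> S k" for y z i j k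
  proof (cases "y = z")
    case True
    then show ?thesis using full[OF that(2)] that(3-6) by blast
  next
    case False
    then show ?thesis using satisfies_cover_relationD(1)[OF sat[OF that(2,1)]] that(3-6) by blast
  qed
  have c_eq: "c y i = {z \<in> Z. i \<in> set_decode (\<sigma> z (y ! j))}" if "y \<in> Z" "j < r" "i \<in> S j" for y i j
    using cons[OF that(1) _ that(2) _ that(3)] that(2,3) by (auto simp: c_def)
  have "inj_on (\<lambda>y. restrict (c y) {..<m}) Z"
  proof (rule inj_onI, rule ccontr)
    fix y y' assume y: "y \<in> Z" "y' \<in> Z" "restrict (c y) {..<m} = restrict (c y') {..<m}" "y \<noteq> y'"
    \<comment> \<open>By \<open>full\<close>, \<open>y\<close> lies in \<open>c y i\<close>, hence
      in \<open>c y' i\<close>. So \<open>\<sigma> y\<close> would be all ones on \<open>y'\<close>,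
      a clause that it satisfies.\<close>
    have "S j \<subseteq> set_decode (\<sigma> y (y' ! j))" if j: "j < r" for j
    proof
      fix i assume i: "i \<in> S j"
      then have "c y i = c y' i" using fun_cong[OF y(3), of i] S[OF j] by auto
      moreover have "y \<in> c y i" using full[OF y(1) j] i y(1) by (auto simp: c_eq[OF _ j])
      ultimately show "i \<in> set_decode (\<sigma> y (y' ! j))" using i y(2) by (simp add: c_eq[OF _ j])
    qed
    then show False
      using satisfies_cover_relationD(2)[OF sat[OF y(1,2)]] y(4) by blast
  qed
  then have "card Z = card ((\<lambda>x. restrict x {..<m}) ` c ` Z)"
    by (simp add: card_image image_image)
  also have "real \<dots> \<le> (\<Prod>j<r. real (card ((\<lambda>x. restrict x (S j \<inter> {..<m})) ` c ` Z))) powr (1 / q)"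
    using \<open>q > 0\<close> cover finite_subset[OF Z finite_lists_length_eq[OF X]]
    by (intro Shearer_inequality) auto
  also have "\<dots> \<le> (\<Prod>j<r. real (card X)) powr (1 / q)"
  proof (intro powr_mono2 prod_mono conjI)
    fix j assume "j \<in> {..<r}"
    then have j: "j < r" by simp
    have "(\<lambda>x. restrict x (S j \<inter> {..<m})) ` c ` Z
        \<subseteq> (\<lambda>v. restrict (\<lambda>i. {z \<in> Z. i \<in> set_decode (\<sigma> z v)}) (S j \<inter> {..<m})) ` X" (is "_ \<subseteq> ?f ` X")
    proof clarify
      fix y assume y: "y \<in> Z"
      have "restrict (c y) (S j \<inter> {..<m}) = ?f (y ! j)"
        using c_eq[OF y j] by (intro restrict_ext) simp
      moreover have "y ! j \<in> X" using y Z j by (auto simp: subset_iff)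
      ultimately show "restrict (c y) (S j \<inter> {..<m}) \<in> ?f ` X" by (rule image_eqI)
    qed
    then have "card ((\<lambda>x. restrict x (S j \<inter> {..<m})) ` c ` Z) \<le> card (?f ` X)"
      using X by (intro card_mono) auto
    also have "\<dots> \<le> card X" using X by (rule card_image_le)
    finally show "real (card ((\<lambda>x. restrict x (S j \<inter> {..<m})) ` c ` Z)) \<le> real (card X)" by simp
  qed (auto intro: prod_nonneg)
  \<comment> \<open>For empty \<open>X\<close> both sides are 0: the product since
    \<open>r > 0\<close>, the right side since \<open>0 powr x = 0\<close>.\<close>
  also have "\<dots> = real (card X) powr (r / q)"
    by (cases "X = {}") (use X \<open>r > 0\<close> in \<open>auto simp: powr_realpow[symmetric] powr_powr zero_power card_gt_0_iff\<close>)
  finally show ?thesis .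
qed

text \<open>With entries in the domain, a clause is violated only through all ones
  (\<open>Z\<close>) or a disagreement at some \<open>(i, j, k)\<close> (\<open>U\<close>). At most
  \<open>r * r * m\<close> triples occur, each accounting for at most \<open>card X\<close>
  clauses.\<close>

lemma non_redundant_cover_relation_card_le:
  assumes nr: "non_redundant (cover_domain m) r (cover_relation m r S) X Y" and "q > 0" "r > 0"
    and S: "\<And>j. j < r \<Longrightarrow> S j \<subseteq> {..<m}" and cover: "\<And>i. i < m \<Longrightarrow> card {j \<in> {..<r}. i \<in> S j} = q"
  shows "real (card Y) \<le> real (card X) powr (r / q) + real (r * r * m * card X)"
proof -
  let ?R = "cover_relation m r S"
  have X: "finite X" and Y: "Y \<subseteq> tuples r X"
    using non_redundant_instance[OF nr] by (simp_all add: csp_instance_def)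
  have fin: "finite Y" using finite_subset[OF Y finite_lists_length_eq[OF X]] .
  have "\<forall>y\<in>Y. \<exists>\<sigma>. \<sigma> \<in> X \<rightarrow>\<^sub>E cover_domain m \<and> (\<forall>y'\<in>Y - {y}. satisfies ?R \<sigma> y') \<and> \<not> satisfies ?R \<sigma> y"
    using nr unfolding non_redundant_def by blast
  then obtain \<sigma> where \<sigma>: "\<And>y. y \<in> Y \<Longrightarrow> \<sigma> y \<in> X \<rightarrow>\<^sub>E cover_domain m"
    and sat: "\<And>y y'. y \<in> Y \<Longrightarrow> y' \<in> Y \<Longrightarrow> y' \<noteq> y \<Longrightarrow> satisfies ?R (\<sigma> y) y'"
    and unsat: "\<And>y. y \<in> Y \<Longrightarrow> \<not> satisfies ?R (\<sigma> y) y"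
    by (metis DiffI singletonD)
  define T where "T = (SIGMA i:{..<m}. {(j, k). j < r \<and> k < r \<and> i \<in> S j \<inter> S k})"
  define U where "U t = (case t of (i, j, k) \<Rightarrow>
      {y \<in> Y. i \<in> set_decode (\<sigma> y (y ! j)) \<longleftrightarrow> i \<notin> set_decode (\<sigma> y (y ! k))})" for t
  define Z where "Z = {y \<in> Y. \<forall>j<r. S j \<subseteq> set_decode (\<sigma> y (y ! j))}"
  have T_sub: "T \<subseteq> {..<m} \<times> {..<r} \<times> {..<r}" by (auto simp: T_def)
  then have T: "finite T" by (rule finite_subset) simp
  have "card T \<le> m * (r * r)"
    using card_mono[OF _ T_sub] by (simp add: card_cartesian_product)
  have "Y \<subseteq> Z \<union> (\<Union>t\<in>T. U t)"
  proof
    fix y assume y: "y \<in> Y"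
    have len: "length y = r" and "set y \<subseteq> X" using Y y by auto
    then have dom: "\<sigma> y ` set y \<subseteq> cover_domain m" using \<sigma>[OF y] by auto
    show "y \<in> Z \<union> (\<Union>t\<in>T. U t)"
    proof (cases "y \<in> Z")
      case False
      then obtain i j k where "j < r" "k < r" "i \<in> S j \<inter> S k"
        "i \<in> set_decode (\<sigma> y (y ! j)) \<longleftrightarrow> i \<notin> set_decode (\<sigma> y (y ! k))"
        using unsat[OF y, unfolded satisfies_cover_relation_iff[OF len dom]] y
        unfolding Z_def by blast
      moreover from this have "i < m" using S[of j] by auto
      ultimately have "(i, j, k) \<in> T" "y \<in> U (i, j, k)" using y by (auto simp: T_def U_def)
      then show ?thesis by blast
    qed simp
  qed
  then have "card Y \<le> card (Z \<union> (\<Union>t\<in>T. U t))"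
    using T fin by (intro card_mono) (auto simp: Z_def U_def split: prod.splits)
  also have "\<dots> \<le> card Z + card (\<Union>t\<in>T. U t)" by (rule card_Un_le)
  also have "card (\<Union>t\<in>T. U t) \<le> (\<Sum>t\<in>T. card (U t))" by (rule card_UN_le[OF T])
  also have "\<dots> \<le> (\<Sum>t\<in>T. card X)"
  proof (rule sum_mono)
    fix t assume "t \<in> T"
    then obtain i j k where t: "t = (i, j, k)" "j < r" "k < r" "i \<in> S j \<inter> S k"
      by (auto simp: T_def)
    show "card (U t) \<le> card X"
      by (rule card_le_inconsistent[OF X _ t(2-4), where \<sigma> = \<sigma> and m = m])
        (use Y sat in \<open>auto simp: U_def t(1)\<close>)
  qed
  also have "\<dots> \<le> r * r * m * card X"
    using \<open>card T \<le> m * (r * r)\<close> mult_le_mono1[of "card T" "m * (r * r)" "card X"]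
    by (simp add: mult.commute mult.left_commute)
  finally have "real (card Y) \<le> real (card Z) + real (r * r * m * card X)"
    by (simp only: of_nat_le_iff of_nat_add[symmetric])
  moreover have "real (card Z) \<le> real (card X) powr (r / q)"
    by (rule card_le_consistent[where \<sigma> = \<sigma>, OF X _ \<open>q > 0\<close> \<open>r > 0\<close> S cover])
      (use Y sat in \<open>auto simp: Z_def\<close>)
  ultimately show ?thesis by linarith
qed

lemma NRD_cover_relation_le:
  assumes "q > 0" "r > 0"
    and "\<And>j. j < r \<Longrightarrow> S j \<subseteq> {..<m}" and "\<And>i. i < m \<Longrightarrow> card {j \<in> {..<r}. i \<in> S j} = q"
  shows "real (NRD (cover_domain m) r (cover_relation m r S) n)
    \<le> real n powr (r / q) + real (r * r * m * n)"
proof -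
  have "NRD (cover_domain m) r (cover_relation m r S) n
      \<in> {card Y | (X :: nat set) Y. non_redundant (cover_domain m) r (cover_relation m r S) X Y \<and> card X = n}"
    unfolding NRD_def by (rule Max_in[OF finite_NRD_set NRD_set_nonempty])
  then show ?thesis
    using non_redundant_cover_relation_card_le[OF _ assms] by auto
qed

section \<open>Lower bound from the grid instance\<close>

lemma NRD_cover_relation_ge:
  assumes S: "\<And>j. j < r \<Longrightarrow> S j \<subseteq> {..<m}" and card_S: "\<And>j. j < r \<Longrightarrow> card (S j) = k"
    and cover: "{..<m} \<subseteq> (\<Union>j<r. S j)" and n: "r * N ^ k \<le> n"
  shows "N ^ m \<le> NRD (cover_domain m) r (cover_relation m r S) n"
proof -
  define P where "P = {..<m} \<rightarrow>\<^sub>E {..<N}"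
  define X0 where "X0 = (SIGMA j:{..<r}. S j \<rightarrow>\<^sub>E {..<N})"
  define cl where "cl x = map (\<lambda>j. (j, restrict x (S j))) [0..<r]" for x :: "nat \<Rightarrow> nat"
  have fin_S: "finite (S j)" if "j < r" for j using S[OF that] finite_subset by blast
  have "card X0 = (\<Sum>j<r. card (S j \<rightarrow>\<^sub>E {..<N}))"
    using fin_S unfolding X0_def by (intro card_SigmaI) (auto intro: finite_PiE)
  also have "\<dots> = r * N ^ k" by (simp add: card_PiE fin_S card_S)
  finally have card_X0: "card X0 \<le> n" using n by simp
  have fin_X0: "finite X0" using fin_S unfolding X0_def by (auto intro: finite_PiE)
  \<comment> \<open>Padding by variables that occur in no clause brings their number to exactly
    \<open>n\<close>.\<close>
  obtain X1 where X1: "X1 \<inter> X0 = {}" "finite X1" "card X1 = n - card X0"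
    using finite_arbitrarily_large_disj[OF _ fin_X0, of "n - card X0"]
    by (auto simp: finite_prod Int_commute)
  define X where "X = X0 \<union> X1"
  have X: "finite X" "card X = n"
    using X1 card_X0 fin_X0 by (auto simp: X_def card_Un_disjoint Int_commute)
  have inj: "inj_on cl P"
  proof (rule inj_onI)
    fix x y assume xy: "x \<in> P" "y \<in> P" "cl x = cl y"
    have "x i = y i" if "i < m" for i
    proof -
      obtain j where j: "j < r" "i \<in> S j" using subsetD[OF cover, of i] \<open>i < m\<close> by auto
      then have "restrict x (S j) = restrict y (S j)"
        using xy(3) by (auto simp: cl_def)
      then have "restrict x (S j) i = restrict y (S j) i" by (rule fun_cong)
      then show ?thesis using j(2) by simp
    qed
    then show "x = y" using xy(1,2) unfolding P_def by (intro PiE_ext[of x _ _ y]) auto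
  qed
  have "non_redundant (cover_domain m) r (cover_relation m r S) X (cl ` P)"
    unfolding non_redundant_def
  proof (intro conjI ballI)
    show "csp_instance r X (cl ` P)"
      using X(1) S by (fastforce simp: csp_instance_def cl_def X_def X0_def P_def PiE_iff)
  next
    fix y assume "y \<in> cl ` P"
    then obtain x where x: "x \<in> P" "y = cl x" by auto
    \<comment> \<open>On clauses, bit \<open>i\<close> depends only on agreement with
      \<open>x\<close> at \<open>i\<close>, so entries never conflict; all ones forces the point
      \<open>x\<close>, as the sets cover. The condition \<open>i < m\<close> keeps values in the
      domain on padding variables too, whose tag is arbitrary.\<close>
    define \<sigma> where "\<sigma> = (\<lambda>(j :: nat, z). set_encode {i. i < m \<and> i \<in> S j \<and> z i = x i})"
    have map_eq: "map (restrict \<sigma> X) (cl w) = map (\<lambda>j. set_encode {i \<in> S j. w i = x i}) [0..<r]"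
      if "w \<in> P" for w
    proof -
      have "(j, restrict w (S j)) \<in> X" if "j < r" for j
        using that S[OF that] \<open>w \<in> P\<close> by (fastforce simp: X_def X0_def P_def PiE_iff)
      moreover have "{i. i < m \<and> i \<in> S j \<and> restrict w (S j) i = x i} = {i \<in> S j. w i = x i}"
        if "j < r" for j using S[OF that] by auto
      ultimately show ?thesis by (auto simp: cl_def \<sigma>_def)
    qed
    have dec: "set_decode (set_encode {i \<in> S j. w i = x i}) = {i \<in> S j. w i = x i}"
      if "j < r" for j w using fin_S[OF that] by simp
    have sat_iff: "satisfies (cover_relation m r S) (restrict \<sigma> X) (cl w) \<longleftrightarrow>
        \<not> (\<forall>j<r. \<forall>i\<in>S j. w i = x i)" if "w \<in> P" for w
    proof -
      have "map (\<lambda>j. set_encode {i \<in> S j. w i = x i}) [0..<r] \<in> tuples r (cover_domain m)"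
        using S by (fastforce simp: cover_domain_def)
      then show ?thesis
        unfolding satisfies_def map_eq[OF that] cover_relation_def by (auto simp: dec cong: conj_cong)
    qed
    have agree: "w = x" if "w \<in> P" "\<forall>j<r. \<forall>i\<in>S j. w i = x i" for w
      using that x(1) cover unfolding P_def by (intro PiE_ext[of w _ _ x]) auto
    show "\<exists>\<sigma>\<in>X \<rightarrow>\<^sub>E cover_domain m. (\<forall>y'\<in>cl ` P - {y}. satisfies (cover_relation m r S) \<sigma> y')
        \<and> \<not> satisfies (cover_relation m r S) \<sigma> y"
    proof (intro bexI[of _ "restrict \<sigma> X"] conjI ballI)
      show "restrict \<sigma> X \<in> X \<rightarrow>\<^sub>E cover_domain m"
        by (auto simp: \<sigma>_def cover_domain_def split: prod.splits)
      show "\<not> satisfies (cover_relation m r S) (restrict \<sigma> X) y"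
        using x by (simp add: sat_iff)
      fix y' assume "y' \<in> cl ` P - {y}"
      then obtain w where "w \<in> P" "y' = cl w" "w \<noteq> x" using x by auto
      then show "satisfies (cover_relation m r S) (restrict \<sigma> X) y'"
        using agree sat_iff by blast
    qed
  qed
  from card_le_NRD[OF this] show ?thesis
    unfolding X(2) card_image[OF inj] by (simp add: P_def card_PiE)
qed

section \<open>Cyclic intervals and the exponent\<close>

text \<open>Translation by \<open>i\<close> permutes the residues mod \<open>p\<close>, with inverse
  translation by \<open>p - i\<close>.\<close>

lemma card_cyclic_interval:
  fixes i p q :: nat
  assumes "q \<le> p" "i < p"
  shows "card {j \<in> {..<p}. (i + j) mod p < q} = q"
proof -
  have "bij_betw (\<lambda>j. (i + j) mod p) {j \<in> {..<p}. (i + j) mod p < q} {..<q}"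
  proof (rule bij_betw_byWitness[where f' = "\<lambda>t. (t + (p - i)) mod p"])
    show "\<forall>j\<in>{j \<in> {..<p}. (i + j) mod p < q}. ((i + j) mod p + (p - i)) mod p = j"
    proof clarify
      fix j assume "j < p"
      then show "((i + j) mod p + (p - i)) mod p = j"
        unfolding mod_add_left_eq using assms(2) by simp
    qed
    show "\<forall>t\<in>{..<q}. (i + (t + (p - i)) mod p) mod p = t"
    proof clarify
      fix t assume "t < q"
      then show "(i + (t + (p - i)) mod p) mod p = t"
        unfolding mod_add_right_eq using assms by simp
    qed
    then show "(\<lambda>t. (t + (p - i)) mod p) ` {..<q} \<subseteq> {j \<in> {..<p}. (i + j) mod p < q}"
      using assms by auto
  qed auto
  then show ?thesis using bij_betw_same_card by fastforce
qed

theorem theorem1p1: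
  fixes p q :: nat
  assumes "p > 0" and "q > 0" and "real p / real q \<ge> 1"
  shows "\<exists>(D :: nat set) (r :: nat) (R :: nat list set).
           finite D \<and> r \<ge> 1 \<and> R \<subseteq> tuples r D \<and>
           (\<exists>c\<^sub>1 > 0. \<exists>c\<^sub>2 > 0. \<forall>\<^sub>F n in sequentially.
              c\<^sub>1 * real n powr (real p / real q) \<le> real (NRD D r R n) \<and>
              real (NRD D r R n) \<le> c\<^sub>2 * real n powr (real p / real q))"
proof -
  have qp: "q \<le> p" using assms by (simp add: field_simps)
  \<comment> \<open>Membership is symmetric in \<open>i\<close> and \<open>j\<close>, so one count
    gives both the size of \<open>S j\<close> and the number of sets containing
    \<open>i\<close>.\<close>
  define S where "S j = {i \<in> {..<p}. (i + j) mod p < q}" for j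
  let ?D = "cover_domain p" and ?R = "cover_relation p p S" and ?e = "real p / real q"
  have S: "S j \<subseteq> {..<p}" for j by (auto simp: S_def)
  have card_S: "card (S j) = q" if "j < p" for j
    using card_cyclic_interval[OF qp that] by (simp add: S_def add.commute)
  have cover: "card {j \<in> {..<p}. i \<in> S j} = q" if "i < p" for i
    using card_cyclic_interval[OF qp that] that by (simp add: S_def)
  have "{..<p} \<subseteq> (\<Union>j<p. S j)"
  proof
    fix i assume "i \<in> {..<p}"
    then have "card {j \<in> {..<p}. i \<in> S j} > 0" using cover[of i] \<open>q > 0\<close> by simp
    then show "i \<in> (\<Union>j<p. S j)" by (auto simp: card_gt_0_iff)
  qed
  note ge = NRD_cover_relation_ge[of p S p, OF S card_S this]
  note le = NRD_cover_relation_le[of q p S p, OF \<open>q > 0\<close> \<open>p > 0\<close> S cover]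
  \<comment> \<open>In \<open>?c1\<close>, \<open>1 / p\<close> comes from the
    \<open>p * N ^ q\<close> variables and \<open>1 / 2\<close> per coordinate from rounding. In
    \<open>?c2\<close>, 1 is the Shearer term and \<open>p * p * p\<close> the linear term, absorbed
    because the exponent is at least 1.\<close>
  let ?c1 = "(1 / 2) ^ p * (1 / real p) powr ?e" and ?c2 = "1 + real (p * p * p)"
  have "?c1 * real n powr ?e \<le> real (NRD ?D p ?R n) \<and> real (NRD ?D p ?R n) \<le> ?c2 * real n powr ?e"
    if "n \<ge> p" for n
  proof
    \<comment> \<open>\<open>t\<close> solves \<open>p * t ^ q = n\<close>; \<open>n \<ge> p\<close>
      gives \<open>t \<ge> 1\<close>, so rounding down at most halves it.\<close>
    define t where "t = (real n / real p) powr (1 / q)"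
    define N where "N = nat \<lfloor>t\<rfloor>"
    have t: "t \<ge> 1" using that \<open>p > 0\<close> \<open>q > 0\<close> by (simp add: t_def ge_one_powr_ge_zero)
    then have "\<lfloor>t\<rfloor> \<ge> 1" by simp
    then have N: "real N \<le> t" "t / 2 \<le> real N" unfolding N_def by linarith+
    have "t ^ q = t powr q" using t by (simp add: powr_realpow)
    also have "\<dots> = real n / real p"
      using \<open>q > 0\<close> \<open>p > 0\<close> by (simp add: t_def powr_powr)
    finally have "t ^ q = real n / real p" .
    then have "real N ^ q \<le> real n / real p" using N(1) power_mono[of "real N" t q] by simp
    then have "real (p * N ^ q) \<le> real n" using \<open>p > 0\<close> by (simp add: field_simps)
    then have "N ^ p \<le> NRD ?D p ?R n" by (intro ge) linarith+
    have "?c1 * real n powr ?e = (1 / 2) ^ p * (real n / real p) powr ?e"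
      by (simp add: powr_divide)
    also have "(real n / real p) powr ?e = t powr p" by (simp add: t_def powr_powr)
    also have "\<dots> = t ^ p" using t by (simp add: powr_realpow)
    also have "(1 / 2) ^ p * t ^ p = (t / 2) ^ p" by (simp add: power_divide)
    also have "\<dots> \<le> real N ^ p" using N(2) t by (intro power_mono) auto
    also have "\<dots> \<le> real (NRD ?D p ?R n)"
      using \<open>N ^ p \<le> NRD ?D p ?R n\<close> by (simp flip: of_nat_power)
    finally show "?c1 * real n powr ?e \<le> real (NRD ?D p ?R n)" .
    have "real n \<le> real n powr ?e"
      using powr_mono[of 1 ?e "real n"] assms that by simp
    then have "real (p * p * p) * real n \<le> real (p * p * p) * real n powr ?e"
      by (intro mult_left_mono) auto
    then show "real (NRD ?D p ?R n) \<le> ?c2 * real n powr ?e"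
      using le[of n] by (simp add: algebra_simps)
  qed
  then have "\<forall>\<^sub>F n in sequentially. ?c1 * real n powr ?e \<le> real (NRD ?D p ?R n) \<and>
      real (NRD ?D p ?R n) \<le> ?c2 * real n powr ?e"
    by (rule eventually_sequentiallyI)
  moreover have "?c1 > 0" "?c2 > 0" using \<open>p > 0\<close> by (auto intro: add_pos_nonneg)
  moreover have "finite ?D" by (simp add: cover_domain_def)
  moreover have "?R \<subseteq> tuples p ?D" by (auto simp: cover_relation_def)
  ultimately show ?thesis using \<open>p > 0\<close>
    by (intro exI[of _ ?D] exI[of _ p] exI[of _ ?R] exI[of _ ?c1] exI[of _ ?c2] conjI) auto
qed

end
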